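(* Let $(X,\sigma)$ be a complete weak partial $b$-metric space (with some real constant $s\ge 1$), and let $T:X\to CB^{\sigma}(X)$ be an $\mathcal{H}_{\sigma_b}^+$-type multivalued contraction, that is: (1') there exists $k\in(0,1)$ such that for all $x,y\in X$, $$\mathcal{H}_{\sigma_b}^+\big(Tx\setminus\{x\},\,Ty\setminus\{y\}\big)\le k\,\sigma(x,y);$$ (2') for every $x\in X$, every $y\in Tx$ and every $\epsilon>0$ there exists $z\in Ty$ such that $$\sigma(y,z)\le \mathcal{H}_{\sigma_b}^+(Tx,Ty)+\epsilon.$$ Then $T$ has a fixed point, i.e. there exists $u^*\in X$ with $u^*\in Tu^*$.
   Context: Weak partial $b$-metric: let $X$ be a nonempty set and $s\ge 1$ a real number. A function $\sigma:X\times X\to[0,\infty)$ is a weak partial $b$-metric on $X$ (and $(X,\sigma)$ is a weak partial $b$-metric space) if for all $x,y,z\in X$: (WPB1) $\sigma(x,x)=\sigma(x,y)\Leftrightarrow x=y$; (WPB2) $\sigma(x,x)\le\sigma(x,y)$; (WPB3) $\sigma(x,y)=\sigma(y,x)$; (WPB4) $\sigma(x,y)\le s[\sigma(x,z)+\sigma(z,y)]$. Completeness: put $\sigma^s(x,y)=\sigma(x,y)-\frac12[\sigma(x,x)+\sigma(y,y)]$ (here the superscript $s$ is only notation). A sequence $\{x_n\}$ is Cauchy in $(X,\sigma)$ if it is Cauchy with respect to $\sigma^s$, i.e. $\sigma^s(x_n,x_m)\to0$ as $n,m\to\infty$. The space $(X,\sigma)$ is complete if $(X,\sigma^s)$ is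 complete, i.e. for every sequence that is Cauchy with respect to $\sigma^s$ there is $x\in X$ with $\sigma^s(x_n,x)\to0$. Closed bounded sets: for $x\in X$ and nonempty $U\subseteq X$ let $\sigma(x,U)=\inf\{\sigma(x,u):u\in U\}$. The closure $\overline U$ is characterized by $u\in\overline U\Leftrightarrow\sigma(u,U)=\sigma(u,u)$, and $U$ is closed if $\overline U=U$. $U$ is bounded if $\sup\{\sigma(u,v):u,v\in U\}<\infty$. $CB^{\sigma}(X)$ denotes the family of all nonempty closed bounded subsets of $(X,\sigma)$. For sets $U,V$, $\delta_\sigma(U,V)=\sup\{\sigma(u,V):u\in U\}$, $\delta_\sigma(V,U)=\sup\{\sigma(v,U):v\in V\}$, and $$\mathcal{H}_{\sigma_b}^+(U,V)=\tfrac12\{\delta_\sigma(U,V)+\delta_\sigma(V,U)\}.$$ The same formula is used for the sets $Tx\setminus\{x\}$, even if they are not closed, with the convention that $\mathcal{H}_{\sigma_b}^+(U,V)=0$ if $U$ or $V$ is empty. *)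

theory Defs
  imports Complex_Main
begin

definition weak_partial_b_metric :: "'a set \<Rightarrow> real \<Rightarrow> ('a \<Rightarrow> 'a \<Rightarrow> real) \<Rightarrow> bool" where
  "weak_partial_b_metric X s \<sigma> \<longleftrightarrow>
     X \<noteq> {} \<and> s \<ge> 1 \<and>
     (\<forall>x\<in>X. \<forall>y\<in>X. 0 \<le> \<sigma> x y) \<and>
     (\<forall>x\<in>X. \<forall>y\<in>X. \<sigma> x x = \<sigma> x y \<longleftrightarrow> x = y) \<and>
     (\<forall>x\<in>X. \<forall>y\<in>X. \<sigma> x x \<le> \<sigma> x y) \<and>
     (\<forall>x\<in>X. \<forall>y\<in>X. \<sigma> x y = \<sigma> y x) \<and>
     (\<forall>x\<in>X. \<forall>y\<in>X. \<forall>z\<in>X. \<sigma> x y \<le> s * (\<sigma> x z + \<sigma> z y))"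

text \<open>The function written \<open>\<sigma>\<^sup>s\<close> on paper; that superscript is unrelated to the constant \<open>s\<close>.\<close>

definition sym_part :: "('a \<Rightarrow> 'a \<Rightarrow> real) \<Rightarrow> 'a \<Rightarrow> 'a \<Rightarrow> real" where
  "sym_part \<sigma> x y = \<sigma> x y - (\<sigma> x x + \<sigma> y y) / 2"

definition wpb_Cauchy :: "('a \<Rightarrow> 'a \<Rightarrow> real) \<Rightarrow> (nat \<Rightarrow> 'a) \<Rightarrow> bool" where
  "wpb_Cauchy \<sigma> f \<longleftrightarrow>
     ((\<lambda>(n, m). sym_part \<sigma> (f n) (f m)) \<longlongrightarrow> 0) (sequentially \<times>\<^sub>F sequentially)"

definition wpb_complete :: "'a set \<Rightarrow> ('a \<Rightarrow> 'a \<Rightarrow> real) \<Rightarrow> bool" where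
  "wpb_complete X \<sigma> \<longleftrightarrow>
     (\<forall>f. range f \<subseteq> X \<and> wpb_Cauchy \<sigma> f \<longrightarrow>
        (\<exists>x\<in>X. (\<lambda>n. sym_part \<sigma> (f n) x) \<longlonglongrightarrow> 0))"

text \<open>The infimum is only meaningful for nonempty \<open>U\<close>; it is not used otherwise.\<close>

definition set_dist :: "('a \<Rightarrow> 'a \<Rightarrow> real) \<Rightarrow> 'a \<Rightarrow> 'a set \<Rightarrow> real" where
  "set_dist \<sigma> x U = (INF u\<in>U. \<sigma> x u)"

definition wpb_closure :: "'a set \<Rightarrow> ('a \<Rightarrow> 'a \<Rightarrow> real) \<Rightarrow> 'a set \<Rightarrow> 'a set" where
  "wpb_closure X \<sigma> U = {u \<in> X. set_dist \<sigma> u U = \<sigma> u u}"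

definition wpb_bounded :: "('a \<Rightarrow> 'a \<Rightarrow> real) \<Rightarrow> 'a set \<Rightarrow> bool" where
  "wpb_bounded \<sigma> U \<longleftrightarrow> bdd_above {\<sigma> u v |u v. u \<in> U \<and> v \<in> U}"

definition CB :: "'a set \<Rightarrow> ('a \<Rightarrow> 'a \<Rightarrow> real) \<Rightarrow> 'a set set" where
  "CB X \<sigma> = {U. U \<subseteq> X \<and> U \<noteq> {} \<and> wpb_closure X \<sigma> U = U \<and> wpb_bounded \<sigma> U}"

text \<open>
  A real supremum suffices: if \<open>U\<close> and \<open>V\<close> are nonempty bounded subsets of a weak partial
  \<open>b\<close>-metric space (or subsets of such sets), the relaxed triangle inequality bounds
  \<open>set_dist \<sigma> u V\<close> for \<open>u \<in> U\<close> from above, so the supremum is the true one.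
\<close>

definition excess :: "('a \<Rightarrow> 'a \<Rightarrow> real) \<Rightarrow> 'a set \<Rightarrow> 'a set \<Rightarrow> real" where
  "excess \<sigma> U V = (SUP u\<in>U. set_dist \<sigma> u V)"

definition H_plus :: "('a \<Rightarrow> 'a \<Rightarrow> real) \<Rightarrow> 'a set \<Rightarrow> 'a set \<Rightarrow> real" where
  "H_plus \<sigma> U V =
     (if U = {} \<or> V = {} then 0 else (excess \<sigma> U V + excess \<sigma> V U) / 2)"

definition H_plus_contraction ::
    "'a set \<Rightarrow> ('a \<Rightarrow> 'a \<Rightarrow> real) \<Rightarrow> ('a \<Rightarrow> 'a set) \<Rightarrow> bool" where
  "H_plus_contraction X \<sigma> T \<longleftrightarrow>
     (\<exists>k. 0 < k \<and> k < 1 \<and>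
        (\<forall>x\<in>X. \<forall>y\<in>X. H_plus \<sigma> (T x - {x}) (T y - {y}) \<le> k * \<sigma> x y)) \<and>
     (\<forall>x\<in>X. \<forall>y\<in>T x. \<forall>\<epsilon>>0. \<exists>z\<in>T y. \<sigma> y z \<le> H_plus \<sigma> (T x) (T y) + \<epsilon>)"

end

(* If T has no fixed point, then T x - {x} = T x is nonempty for all x, so the contraction
   condition becomes H_plus (T x) (T y) <= k * sigma x y.  As sigma x y > 0 for y in T x, the
   slack epsilon in condition (2') can be absorbed into a ratio q in (k,1), which yields an
   orbit with sigma (f n) (f (n+1)) <= C * q^n.  Such a sequence is Cauchy for every q < 1,
   even when s * q >= 1.  Its limit u satisfies sigma u u = 0, because
   sigma u u <= sigma (f n) u --> sigma u u / 2; the contraction condition then gives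
   sigma(u, T u) = 0, and u lies in the closed set T u after all. *)

theory Submission imports Defs begin

lemma wpbD:
  assumes "weak_partial_b_metric X s \<sigma>"
  shows wpb_s_ge_1: "1 \<le> s"
    and wpb_nonempty: "X \<noteq> {}"
    and wpb_nonneg: "\<And>x y. \<lbrakk>x \<in> X; y \<in> X\<rbrakk> \<Longrightarrow> 0 \<le> \<sigma> x y"
    and wpb_eq_iff: "\<And>x y. \<lbrakk>x \<in> X; y \<in> X\<rbrakk> \<Longrightarrow> \<sigma> x x = \<sigma> x y \<longleftrightarrow> x = y"
    and wpb_self_le: "\<And>x y. \<lbrakk>x \<in> X; y \<in> X\<rbrakk> \<Longrightarrow> \<sigma> x x \<le> \<sigma> x y"
    and wpb_sym: "\<And>x y. \<lbrakk>x \<in> X; y \<in> X\<rbrakk> \<Longrightarrow> \<sigma> x y = \<sigma> y x"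
    and wpb_triangle:
      "\<And>x y z. \<lbrakk>x \<in> X; y \<in> X; z \<in> X\<rbrakk> \<Longrightarrow> \<sigma> x y \<le> s * (\<sigma> x z + \<sigma> z y)"
  using assms unfolding weak_partial_b_metric_def by blast+

lemma wpb_pos:
  assumes "weak_partial_b_metric X s \<sigma>" "x \<in> X" "y \<in> X" "x \<noteq> y"
  shows "0 < \<sigma> x y"
  using wpb_nonneg[OF assms(1), of x x] wpb_self_le[OF assms(1), of x y]
    wpb_eq_iff[OF assms(1), of x y] assms(2-4)
  by linarith

text \<open>Both self-distances are at most \<open>\<sigma> x y\<close>, hence so is their average.
  With \<open>sym_part_le\<close> this squeezes \<open>sym_part\<close> between 0 and \<sigma>, so
  smallness of \<sigma> yields the Cauchy property.\<close>

lemma sym_part_nonneg: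
  assumes "weak_partial_b_metric X s \<sigma>" "x \<in> X" "y \<in> X"
  shows "0 \<le> sym_part \<sigma> x y"
  using wpb_self_le[OF assms] wpb_self_le[OF assms(1,3,2)] wpb_sym[OF assms]
  by (simp add: sym_part_def)

lemma sym_part_le:
  assumes "weak_partial_b_metric X s \<sigma>" "x \<in> X" "y \<in> X"
  shows "sym_part \<sigma> x y \<le> \<sigma> x y"
  using wpb_nonneg[OF assms(1), of x x] wpb_nonneg[OF assms(1), of y y] assms(2,3)
  by (simp add: sym_part_def)

lemma wpb_bdd_below:
  assumes "weak_partial_b_metric X s \<sigma>" "x \<in> X" "U \<subseteq> X"
  shows "bdd_below (\<sigma> x ` U)"
  using wpb_nonneg[OF assms(1,2)] assms(3) by (intro bdd_belowI[of _ 0]) auto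

lemma set_dist_nonneg:
  assumes "weak_partial_b_metric X s \<sigma>" "x \<in> X" "U \<subseteq> X" "U \<noteq> {}"
  shows "0 \<le> set_dist \<sigma> x U"
  unfolding set_dist_def using wpb_nonneg[OF assms(1,2)] assms(3,4)
  by (intro cINF_greatest) auto

lemma set_dist_triangle:
  assumes wpb: "weak_partial_b_metric X s \<sigma>" and x: "x \<in> X" and y: "y \<in> X"
    and U: "U \<subseteq> X" "U \<noteq> {}"
  shows "set_dist \<sigma> x U \<le> s * (\<sigma> x y + set_dist \<sigma> y U)"
proof -
  have s: "0 < s" using wpb_s_ge_1[OF wpb] by simp
  \<comment> \<open>In this form the left side is a lower bound for every
    \<open>\<sigma> y u\<close>, so it passes to the infimum.\<close>
  have "set_dist \<sigma> x U / s - \<sigma> x y \<le> set_dist \<sigma> y U"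
    unfolding set_dist_def[of _ y]
  proof (rule cINF_greatest[OF U(2)])
    fix u assume u: "u \<in> U"
    have "set_dist \<sigma> x U \<le> \<sigma> x u"
      unfolding set_dist_def using wpb_bdd_below[OF wpb x U(1)] u by (rule cINF_lower)
    also have "\<dots> \<le> s * (\<sigma> x y + \<sigma> y u)"
      using wpb_triangle[OF wpb x _ y] u U(1) by blast
    finally show "set_dist \<sigma> x U / s - \<sigma> x y \<le> \<sigma> y u"
      using s by (simp add: field_simps)
  qed
  then show ?thesis using s by (simp add: field_simps)
qed

text \<open>Routing through one anchor point of \<open>U\<close> bounds all distances to
  \<open>V\<close> at once. This makes the real supremum in \<open>excess\<close> a genuine upper
  bound.\<close>

lemma bdd_above_set_dist:
  assumes wpb: "weak_partial_b_metric X s \<sigma>"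
    and U: "U \<subseteq> X" "wpb_bounded \<sigma> U" and V: "V \<subseteq> X" "V \<noteq> {}"
  shows "bdd_above ((\<lambda>u. set_dist \<sigma> u V) ` U)"
proof (cases "U = {}")
  case False
  then obtain a where a: "a \<in> U" by blast
  obtain M where M: "\<And>u v. \<lbrakk>u \<in> U; v \<in> U\<rbrakk> \<Longrightarrow> \<sigma> u v \<le> M"
    using U(2) unfolding wpb_bounded_def bdd_above_def by blast
  show ?thesis
  proof (rule bdd_aboveI2)
    fix u assume u: "u \<in> U"
    have "set_dist \<sigma> u V \<le> s * (\<sigma> u a + set_dist \<sigma> a V)"
      using set_dist_triangle[OF wpb] u a U(1) V by blast
    also have "\<dots> \<le> s * (M + set_dist \<sigma> a V)"
      using M[OF u a] wpb_s_ge_1[OF wpb] by (intro mult_left_mono) auto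
    finally show "set_dist \<sigma> u V \<le> s * (M + set_dist \<sigma> a V)" .
  qed
qed simp

lemma set_dist_le_excess:
  assumes "weak_partial_b_metric X s \<sigma>" "U \<in> CB X \<sigma>" "V \<in> CB X \<sigma>" "u \<in> U"
  shows "set_dist \<sigma> u V \<le> excess \<sigma> U V"
  unfolding excess_def using assms
  by (intro cSUP_upper bdd_above_set_dist) (auto simp: CB_def)

text \<open>\<open>H_plus\<close> averages two excesses; the one dropped here is nonnegative, and
  undoing the average costs the factor 2.\<close>

lemma set_dist_le_H_plus:
  assumes wpb: "weak_partial_b_metric X s \<sigma>"
    and U: "U \<in> CB X \<sigma>" and V: "V \<in> CB X \<sigma>" and u: "u \<in> U"
  shows "set_dist \<sigma> u V \<le> 2 * H_plus \<sigma> U V"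
proof -
  obtain v where v: "v \<in> V" using V unfolding CB_def by blast
  have "0 \<le> set_dist \<sigma> v U"
    using U V v by (intro set_dist_nonneg[OF wpb]) (auto simp: CB_def)
  then have "0 \<le> excess \<sigma> V U"
    using set_dist_le_excess[OF wpb V U v] by linarith
  then show ?thesis
    using set_dist_le_excess[OF wpb U V u] u v by (auto simp: H_plus_def)
qed

text \<open>
  Jumping in blocks of a fixed length \<open>L\<close> with \<open>s * q ^ L \<le> 1/2\<close> replaces the ratio \<open>q\<close> by one
  for which the relaxed triangle inequality can be iterated; this is why \<open>s * q < 1\<close> need not
  be assumed.
\<close>

lemma geometric_b_metric_bound:
  fixes D :: "nat \<Rightarrow> nat \<Rightarrow> real"
  assumes s: "1 \<le> s" and q: "0 < q" "q < 1"
    and triangle: "\<And>i j l. D i j \<le> s * (D i l + D l j)"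
    and self: "\<And>n. D n n \<le> D n (Suc n)"
    and step: "\<And>n. D n (Suc n) \<le> C * q ^ n" and C: "0 \<le> C"
  obtains K where "\<And>n m. D n (n + m) \<le> K * q ^ n"
proof -
  \<comment> \<open>Crude bound: each extra step costs a factor \<open>2 * s\<close>, so it is
    useful only for bounded \<open>m\<close>. Self-distances need not vanish, so even the case
    \<open>m = 0\<close> goes through \<open>self\<close>.\<close>
  have short: "D n (n + m) \<le> C * (2 * s) ^ m * q ^ n" for n m
  proof (induction m arbitrary: n)
    case 0
    then show ?case using self[of n] step[of n] by simp
  next
    case (Suc m)
    have "C * (2 * s) ^ m * q ^ Suc n \<le> C * (2 * s) ^ m * q ^ n"
      using s q C by (intro mult_left_mono) (auto simp: mult_left_le_one_le)
    then have "D (Suc n) (Suc n + m) \<le> C * (2 * s) ^ m * q ^ n"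
      using Suc.IH[of "Suc n"] by linarith
    moreover have "C * 1 * q ^ n \<le> C * (2 * s) ^ m * q ^ n"
      using s q C by (intro mult_right_mono mult_left_mono one_le_power) auto
    then have "D n (Suc n) \<le> C * (2 * s) ^ m * q ^ n"
      using step[of n] by simp
    ultimately have "s * (D n (Suc n) + D (Suc n) (Suc n + m))
        \<le> s * (C * (2 * s) ^ m * q ^ n + C * (2 * s) ^ m * q ^ n)"
      using s by (intro mult_left_mono add_mono) auto
    then show ?case
      using triangle[of n "n + Suc m" "Suc n"] by (simp add: algebra_simps)
  qed
  obtain L where L: "q ^ L < 1 / (2 * s)"
    using real_arch_pow_inv[of "1 / (2 * s)" q] s q by auto
  then have sL: "s * q ^ L \<le> 1 / 2" using s by (simp add: field_simps)
  \<comment> \<open>Blocks of positive length make \<open>m - L\<close> smaller than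
    \<open>m\<close> in the strong induction below.\<close>
  then have "L \<noteq> 0" using s by (intro notI) simp
  define M where "M = C * (2 * s) ^ L"
  have M: "0 \<le> M" using C s by (simp add: M_def)
  have short': "D n (n + m) \<le> M * q ^ n" if "m \<le> L" for n m
  proof -
    have "C * (2 * s) ^ m * q ^ n \<le> M * q ^ n"
      unfolding M_def using s q C that
      by (intro mult_right_mono mult_left_mono power_increasing) auto
    then show ?thesis using short[of n m] by linarith
  qed
  \<comment> \<open>The constant \<open>2 * s * M\<close> reproduces itself: the first block
    contributes \<open>s * M\<close>, and the rest at most \<open>2 * s * M * (s * q ^ L)\<close>,
    which is again at most \<open>s * M\<close>.\<close>
  have "D n (n + m) \<le> 2 * s * M * q ^ n" for n m
  proof (induction m arbitrary: n rule: less_induct)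
    case (less m)
    show ?case
    proof (cases "m \<le> L")
      case True
      have "1 * (M * q ^ n) \<le> 2 * s * (M * q ^ n)"
        using s q M by (intro mult_right_mono) auto
      then show ?thesis using short'[OF True, of n] by (simp add: mult.assoc)
    next
      case False
      have "D (n + L) (n + m) \<le> 2 * s * M * q ^ (n + L)"
        using less.IH[of "m - L" "n + L"] False \<open>L \<noteq> 0\<close> by simp
      then have "D n (n + m) \<le> s * (M * q ^ n + 2 * s * M * q ^ (n + L))"
        using triangle[of n "n + m" "n + L"] short'[of L n] s
        by (smt (verit) le_refl mult_left_mono)
      also have "\<dots> = s * M * q ^ n + 2 * s * M * q ^ n * (s * q ^ L)"
        by (simp add: power_add algebra_simps)
      also have "\<dots> \<le> s * M * q ^ n + 2 * s * M * q ^ n * (1 / 2)"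
        using sL s q M by (intro add_left_mono mult_left_mono) auto
      finally show ?thesis by (simp add: mult_ac)
    qed
  qed
  then show thesis by (rule that)
qed

text \<open>Completeness gives convergence for \<open>sym_part\<close> only. It lifts to \<sigma>
  because the self-distances along the sequence, and then that of the limit, are shown to
  vanish.\<close>

lemma geometric_imp_limit:
  assumes wpb: "weak_partial_b_metric X s \<sigma>" and complete: "wpb_complete X \<sigma>"
    and f: "\<And>n. f n \<in> X"
    and q: "0 < q" "q < 1" and step: "\<And>n. \<sigma> (f n) (f (Suc n)) \<le> C * q ^ n" and C: "0 \<le> C"
  obtains u where "u \<in> X" "\<sigma> u u = 0" "(\<lambda>n. \<sigma> (f n) u) \<longlonglongrightarrow> 0"
proof -
  obtain K where K: "\<And>n m. \<sigma> (f n) (f (n + m)) \<le> K * q ^ n"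
    using geometric_b_metric_bound[of s q "\<lambda>i j. \<sigma> (f i) (f j)" C]
      wpb_s_ge_1[OF wpb] q step C wpb_triangle[OF wpb f f f] wpb_self_le[OF wpb f f]
    by blast
  have K0: "0 \<le> K" using K[of 0 0] wpb_nonneg[OF wpb f f, of 0 0] by simp
  \<comment> \<open>The sum covers both orders of the indices and splits into one null sequence per
    factor of the product filter.\<close>
  have bound: "\<sigma> (f n) (f m) \<le> K * q ^ n + K * q ^ m" for n m
  proof (cases "n \<le> m")
    case True
    then show ?thesis using K[of n "m - n"] K0 q by (simp add: add_increasing2)
  next
    case False
    then show ?thesis
      using K[of m "n - m"] K0 q wpb_sym[OF wpb f f, of n m] by (simp add: add_increasing)
  qed
  have Kq: "(\<lambda>n. K * q ^ n) \<longlonglongrightarrow> 0"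
    using q by (intro tendsto_mult_right_zero LIMSEQ_power_zero) simp
  have "((\<lambda>(n, m). K * q ^ n + K * q ^ m) \<longlongrightarrow> 0) (sequentially \<times>\<^sub>F sequentially)"
    using tendsto_add[OF filterlim_compose[OF Kq filtermap_fst_prod_filter[folded filterlim_def]]
        filterlim_compose[OF Kq filtermap_snd_prod_filter[folded filterlim_def]]]
    by (simp add: case_prod_unfold)
  then have "wpb_Cauchy \<sigma> f"
    unfolding wpb_Cauchy_def
    by (rule tendsto_sandwich[OF _ _ tendsto_const, rotated -1])
      (auto intro!: always_eventually sym_part_nonneg[OF wpb] f
        order_trans[OF sym_part_le[OF wpb] bound])
  then obtain u where u: "u \<in> X" and lim: "(\<lambda>n. sym_part \<sigma> (f n) u) \<longlonglongrightarrow> 0"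
    using complete f unfolding wpb_complete_def by blast
  have "(\<lambda>n. \<sigma> (f n) (f n)) \<longlonglongrightarrow> 0"
    using K[of _ 0] wpb_nonneg[OF wpb f f]
    by (intro tendsto_sandwich[OF _ _ tendsto_const Kq]) auto
  \<comment> \<open>Adding the self-distances back recovers \<open>\<sigma> (f n) u\<close>; only
    half of \<open>\<sigma> u u\<close> survives in the limit.\<close>
  then have "(\<lambda>n. sym_part \<sigma> (f n) u + (\<sigma> (f n) (f n) + \<sigma> u u) / 2) \<longlonglongrightarrow> 0 + (0 + \<sigma> u u) / 2"
    by (intro tendsto_intros lim) simp_all
  then have lim2: "(\<lambda>n. \<sigma> (f n) u) \<longlonglongrightarrow> \<sigma> u u / 2"
    by (simp add: sym_part_def)
  have "\<sigma> u u \<le> \<sigma> (f n) u" for n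
    using wpb_self_le[OF wpb u f] wpb_sym[OF wpb u f] by metis
  then have "\<sigma> u u \<le> \<sigma> u u / 2"
    using LIMSEQ_le_const[OF lim2] by blast
  then have "\<sigma> u u = 0" using wpb_nonneg[OF wpb u u] by linarith
  then show thesis using that u lim2 by simp
qed

theorem theorem4p1:
  fixes X :: "'a set" and \<sigma> :: "'a \<Rightarrow> 'a \<Rightarrow> real" and s :: real and T :: "'a \<Rightarrow> 'a set"
  assumes "weak_partial_b_metric X s \<sigma>"
    and "wpb_complete X \<sigma>"
    and "\<And>x. x \<in> X \<Longrightarrow> T x \<in> CB X \<sigma>"
    and "H_plus_contraction X \<sigma> T"
  shows "\<exists>u\<in>X. u \<in> T u"
proof (rule ccontr)
  assume "\<not> ?thesis"
  then have nofix: "\<And>x. x \<in> X \<Longrightarrow> x \<notin> T x" by blast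
  note wpb = assms(1) and CB = assms(3)
  have TX: "T x \<subseteq> X" "T x \<noteq> {}" if "x \<in> X" for x
    using CB[OF that] by (auto simp: CB_def)
  obtain k where k: "0 < k" "k < 1"
    and "\<And>x y. \<lbrakk>x \<in> X; y \<in> X\<rbrakk> \<Longrightarrow> H_plus \<sigma> (T x - {x}) (T y - {y}) \<le> k * \<sigma> x y"
    using assms(4) unfolding H_plus_contraction_def by blast
  then have contr: "H_plus \<sigma> (T x) (T y) \<le> k * \<sigma> x y" if "x \<in> X" "y \<in> X" for x y
    using that nofix by simp
  \<comment> \<open>Any value strictly between \<open>k\<close> and 1 would do: the slack granted by
    the second contraction condition will be \<open>(q - k) * \<sigma> x y\<close>.\<close>
  define q where "q = (k + 1) / 2"
  have q: "0 < q" "q < 1" "k < q" using k by (auto simp: q_def)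
  have next_point: "\<exists>z\<in>T y. \<sigma> y z \<le> q * \<sigma> x y" if x: "x \<in> X" and y: "y \<in> T x" for x y
  proof -
    have yX: "y \<in> X" using TX x y by blast
    have "0 < \<sigma> x y" using wpb_pos[OF wpb x yX] nofix x y by blast
    then have "0 < (q - k) * \<sigma> x y" using q by simp
    then obtain z where "z \<in> T y" "\<sigma> y z \<le> H_plus \<sigma> (T x) (T y) + (q - k) * \<sigma> x y"
      using assms(4) x y unfolding H_plus_contraction_def by blast
    then show ?thesis using contr[OF x yX] by (auto simp: algebra_simps intro!: bexI[of _ z])
  qed
  \<comment> \<open>The choice runs over pairs of consecutive orbit points, since the next point
    depends on both.\<close>
  have "\<exists>p. \<forall>n. (fst (p n) \<in> X \<and> snd (p n) \<in> T (fst (p n))) \<and>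
      (fst (p (Suc n)) = snd (p n) \<and>
       \<sigma> (fst (p (Suc n))) (snd (p (Suc n))) \<le> q * \<sigma> (fst (p n)) (snd (p n)))"
  proof (rule dependent_nat_choice)
    show "\<exists>a. fst a \<in> X \<and> snd a \<in> T (fst a)"
      using wpb_nonempty[OF wpb] TX by fastforce
  next
    fix a assume a: "fst a \<in> X \<and> snd a \<in> T (fst a)"
    then obtain z where "z \<in> T (snd a)" "\<sigma> (snd a) z \<le> q * \<sigma> (fst a) (snd a)"
      using next_point by blast
    then show "\<exists>b. (fst b \<in> X \<and> snd b \<in> T (fst b)) \<and>
        fst b = snd a \<and> \<sigma> (fst b) (snd b) \<le> q * \<sigma> (fst a) (snd a)"
      using a TX by (intro exI[of _ "(snd a, z)"]) auto
  qed
  then obtain p where p: "\<And>n. fst (p n) \<in> X \<and> snd (p n) \<in> T (fst (p n))"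
    and p_Suc: "\<And>n. fst (p (Suc n)) = snd (p n) \<and>
        \<sigma> (fst (p (Suc n))) (snd (p (Suc n))) \<le> q * \<sigma> (fst (p n)) (snd (p n))"
    by blast
  define f where "f = fst \<circ> p"
  have f: "f n \<in> X" "f (Suc n) \<in> T (f n)" for n
    using p[of n] p_Suc[of n] by (auto simp: f_def)
  have step: "\<sigma> (f n) (f (Suc n)) \<le> \<sigma> (f 0) (f 1) * q ^ n" for n
  proof (induction n)
    case (Suc n)
    have "\<sigma> (f (Suc n)) (f (Suc (Suc n))) \<le> q * \<sigma> (f n) (f (Suc n))"
      unfolding f_def comp_def using p_Suc[of n] p_Suc[of "Suc n"] by metis
    also have "\<dots> \<le> q * (\<sigma> (f 0) (f 1) * q ^ n)"
      using Suc q by (intro mult_left_mono) auto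
    finally show ?case by (simp add: mult_ac)
  qed simp
  obtain u where u: "u \<in> X" "\<sigma> u u = 0" and lim: "(\<lambda>n. \<sigma> (f n) u) \<longlonglongrightarrow> 0"
    using geometric_imp_limit[OF wpb assms(2) f(1) q(1,2) step] wpb_nonneg[OF wpb f(1) f(1)]
    by blast
  \<comment> \<open>The detour goes through \<open>f (Suc n)\<close>, which lies in
    \<open>T (f n)\<close>, so its distance to \<open>T u\<close> is controlled by
    \<open>H_plus \<sigma> (T (f n)) (T u)\<close>.\<close>
  have "set_dist \<sigma> u (T u) \<le> s * (\<sigma> (f (Suc n)) u + 2 * (k * \<sigma> (f n) u))" for n
  proof -
    have "set_dist \<sigma> u (T u) \<le> s * (\<sigma> u (f (Suc n)) + set_dist \<sigma> (f (Suc n)) (T u))"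
      using set_dist_triangle[OF wpb u(1) f(1) TX[OF u(1)]] .
    also have "\<dots> \<le> s * (\<sigma> (f (Suc n)) u + 2 * (k * \<sigma> (f n) u))"
      using set_dist_le_H_plus[OF wpb CB[OF f(1)] CB[OF u(1)] f(2), of n]
        contr[OF f(1) u(1), of n] wpb_sym[OF wpb u(1) f(1), of "Suc n"] wpb_s_ge_1[OF wpb]
      by (intro mult_left_mono) auto
    finally show ?thesis .
  qed
  moreover have "(\<lambda>n. s * (\<sigma> (f (Suc n)) u + 2 * (k * \<sigma> (f n) u))) \<longlonglongrightarrow> s * (0 + 2 * (k * 0))"
    by (intro tendsto_intros lim LIMSEQ_Suc)
  ultimately have "set_dist \<sigma> u (T u) \<le> s * (0 + 2 * (k * 0))"
    using LIMSEQ_le_const by blast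
  then have "set_dist \<sigma> u (T u) = \<sigma> u u"
    using set_dist_nonneg[OF wpb u(1) TX[OF u(1)]] u(2) by simp
  then have "u \<in> wpb_closure X \<sigma> (T u)" using u(1) by (simp add: wpb_closure_def)
  then have "u \<in> T u" using CB[OF u(1)] by (simp add: CB_def)
  then show False using nofix u(1) by blast
qed

end
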